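(* Let $g=m\alpha+\beta$ with integers $\alpha\geq 0$ and $0\leq \beta<m$ (and $g\geq 1$). Then the limit $P(g) := \lim_{n\to\infty} P_n(g)$ exists, and \[ P(g)\ = \ \begin{cases} \frac{\beta}{m(m+1)}&\mbox{if $\alpha=0$}\\[2pt] \frac{m+1-\beta}{(m+1)^{\alpha+1}}&\mbox{if $\alpha> 0$.} \end{cases} \]
   Context: Fix an integer $m\geq 1$. For an increasing sequence of positive integers $\{a_n\}_{n=0}^\infty$, partition its terms into bins $b_0=[a_0]$ and $b_k=[a_{m(k-1)+1},a_{m(k-1)+2},\ldots,a_{mk}]$ for $k\geq 1$. A decomposition $z=a_{\ell_t}+\cdots+a_{\ell_1}$ with $\ell_1<\ell_2<\cdots<\ell_t$ is a legal $m$-gonal decomposition if no two summands lie in the same bin. The $m$-gonal sequence is the increasing sequence in which each $a_i$ is the smallest positive integer with no legal $m$-gonal decomposition using $a_0,\ldots,a_{i-1}$; explicitly $a_0=1$ and $a_{km+r}=2r(m+1)^k$ for $k\geq 0$, $1\leq r\leq m$. Every nonnegative integer has a unique legal $m$-gonal decomposition. For $z\in[0,a_{mn+1})$ with legal $m$-gonal decomposition $z=a_{\ell_t}+\cdots+a_{\ell_1}$, $\ell_1<\cdots<\ell_t$, define the multiset of gaps $\mathrm{Gaps}_n(z)=\{\ell_2-\ell_1,\ell_3-\ell_2,\ldots,\ell_t-\ell_{t-1}\}$ (the quantity $\ell_1-0$ is not counted as a gap). Considering all gaps between summands in the legal $m$-gonal decompositions of all $z\in[0,a_{mn+1})$, let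 $P_n(g)$ be the fraction of these gaps that have length $g$. *)

theory Defs
  imports Complex_Main "HOL-Library.Multiset"
begin

text \<open>Terms of the sequence are represented by their indices, so a bin is a set of indices and a
  decomposition is a finite set of indices \<open>\<ell>\<^sub>1 < \<dots> < \<ell>\<^sub>t\<close>; the empty set decomposes \<open>0\<close>.\<close>

definition bin :: "nat \<Rightarrow> nat \<Rightarrow> nat set" where
  "bin m k = (if k = 0 then {0} else {m * (k - 1) + 1..m * k})"

definition legal :: "nat \<Rightarrow> nat set \<Rightarrow> bool" where
  "legal m S \<longleftrightarrow> finite S \<and> (\<forall>k. card (S \<inter> bin m k) \<le> 1)"

text \<open>The greedy definition. The least element always exists, as only finitely many index sets
  \<open>S \<subseteq> {..<i}\<close> are available. In closed form, \<open>gonal m 0 = 1\<close> and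
  \<open>gonal m (k * m + r) = 2 * r * (m + 1) ^ k\<close> for \<open>1 \<le> r \<le> m\<close>.\<close>

function gonal :: "nat \<Rightarrow> nat \<Rightarrow> nat" where
  "gonal m i =
     (LEAST z. 0 < z \<and> z \<notin> (\<lambda>S. \<Sum>j\<in>S. gonal m j) ` {S. S \<subseteq> {..<i} \<and> legal m S})"
  by pat_completeness auto
termination
  by (relation "measure snd") auto

declare gonal.simps [simp del]

definition legal_decomposition :: "nat \<Rightarrow> nat \<Rightarrow> nat set \<Rightarrow> bool" where
  "legal_decomposition m z S \<longleftrightarrow> legal m S \<and> z = (\<Sum>j\<in>S. gonal m j)"

text \<open>For \<open>m \<ge> 1\<close> every natural number has exactly one legal decomposition.\<close>

definition the_decomposition :: "nat \<Rightarrow> nat \<Rightarrow> nat set" where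
  "the_decomposition m z = (THE S. legal_decomposition m z S)"

definition gaps :: "nat \<Rightarrow> nat \<Rightarrow> nat multiset" where
  "gaps m z = (let l = sorted_list_of_set (the_decomposition m z)
               in mset (map (\<lambda>i. l ! (i + 1) - l ! i) [0..<length l - 1]))"

definition all_gaps :: "nat \<Rightarrow> nat \<Rightarrow> nat multiset" where
  "all_gaps m n = (\<Sum>z\<in>{0..<gonal m (m * n + 1)}. gaps m z)"

definition gap_fraction :: "nat \<Rightarrow> nat \<Rightarrow> nat \<Rightarrow> real" where
  "gap_fraction m n g = real (count (all_gaps m n) g) / real (size (all_gaps m n))"

end

theory Submission
  imports Defs
begin

text \<open>Decompositions of the numbers below \<open>a\<^bsub>mn+1\<^esub>\<close> are the legal index sets inside the first \<open>n + 1\<close>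
  bins. Passing from \<open>n\<close> to \<open>n + 1\<close>, each such set \<open>S\<close> is either kept or extended by one of the \<open>m\<close>
  indices \<open>i\<close> of the next bin, and an extension of a nonempty \<open>S\<close> creates the single new gap
  \<open>i - Max S\<close>. The sets with a prescribed maximum are counted exactly, so the total number of
  gaps and the number of gaps equal to \<open>g\<close> satisfy, for large \<open>n\<close>, recurrences \<open>x\<^bsub>n+1\<^esub> = (m + 1) x\<^sub>n + K (m + 1)\<^sup>n\<close>,
  up to a bounded error for the former. Both therefore grow like
  \<open>n (m + 1)\<^sup>n\<close>, and \<open>P(g)\<close> is the quotient of the two constants.\<close>

section \<open>Legal sets and the closed form of the sequence\<close>

definition legal_sets :: "nat \<Rightarrow> nat \<Rightarrow> nat set set" where
  "legal_sets m i = {S. S \<subseteq> {..<i} \<and> legal m S}"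

definition bin_start :: "nat \<Rightarrow> nat \<Rightarrow> nat" where
  "bin_start m i = (if i = 0 then 0 else m * ((i - 1) div m) + 1)"

text \<open>For i > 0 write i = k * m + r with 1 \<le> r \<le> m: bin 0 being a singleton shifts
  everything by one, so k is \<open>(i - 1) div m\<close> and r is
  \<open>(i - 1) mod m + 1\<close>.\<close>

definition gonal_closed :: "nat \<Rightarrow> nat \<Rightarrow> nat" where
  "gonal_closed m i =
     (if i = 0 then 1 else 2 * ((i - 1) mod m + 1) * (m + 1) ^ ((i - 1) div m))"

lemma finite_legal_sets: "finite (legal_sets m i)"
  unfolding legal_sets_def by (rule finite_subset[of _ "Pow {..<i}"]) auto

lemma legal_sets_finite: "S \<in> legal_sets m i \<Longrightarrow> finite S"
  unfolding legal_sets_def legal_def by auto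

lemma empty_in_legal_sets: "{} \<in> legal_sets m i"
  by (simp add: legal_sets_def legal_def)

lemma legal_sets_0: "legal_sets m 0 = {{}}"
  by (auto simp: legal_sets_def legal_def)

lemma legal_sets_mono: "i \<le> j \<Longrightarrow> legal_sets m i \<subseteq> legal_sets m j"
  unfolding legal_sets_def by auto

context
  fixes m :: nat
  assumes m: "m \<ge> 1"
begin

section \<open>Adding a largest index to a legal set\<close>

lemma bin_Suc_iff: "Suc j \<in> bin m k \<longleftrightarrow> k = Suc (j div m)"
proof (cases k)
  case 0
  then show ?thesis by (simp add: bin_def)
next
  case (Suc q)
  have "Suc j \<in> bin m k \<longleftrightarrow> m * q \<le> j \<and> j < m * Suc q"
    using Suc by (auto simp: bin_def)
  also have "\<dots> \<longleftrightarrow> j div m = q"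
  proof -
    have "m * q \<le> j \<longleftrightarrow> q \<le> j div m"
      using m by (simp add: less_eq_div_iff_mult_less_eq mult.commute)
    moreover have "j < m * Suc q \<longleftrightarrow> j div m < Suc q"
      using m by (simp add: div_less_iff_less_mult mult.commute del: mult_Suc mult_Suc_right)
    ultimately show ?thesis by linarith
  qed
  finally show ?thesis using Suc by auto
qed

lemma zero_in_bin_iff: "0 \<in> bin m k \<longleftrightarrow> k = 0"
  by (simp add: bin_def)

lemma ex1_bin: "\<exists>!k. i \<in> bin m k"
  by (cases i) (auto simp: bin_Suc_iff zero_in_bin_iff)

lemma bin_start_le: "bin_start m i \<le> i"
  using m by (cases i) (auto simp: bin_start_def)

lemma same_bin_iff:
  assumes "y < i" "i \<in> bin m k"
  shows "y \<in> bin m k \<longleftrightarrow> bin_start m i \<le> y"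
proof -
  obtain j where j: "i = Suc j" using assms by (cases i) auto
  have k: "k = Suc (j div m)" using assms(2) bin_Suc_iff j by simp
  show ?thesis
  proof (cases y)
    case 0
    then show ?thesis using j k by (simp add: bin_def bin_start_def)
  next
    case (Suc q)
    have "q \<le> j" using Suc assms j by simp
    then have "q div m \<le> j div m" by (rule div_le_mono)
    moreover have "j div m \<le> q div m \<longleftrightarrow> m * (j div m) \<le> q"
      using m by (simp add: less_eq_div_iff_mult_less_eq mult.commute)
    ultimately show ?thesis using Suc j k by (auto simp: bin_Suc_iff bin_start_def)
  qed
qed

text \<open>Only the bin of \<open>i\<close> gains an element, so it must have been empty before.
  Bins are intervals, so for a set below \<open>i\<close> this means lying entirely before the first
  index of that bin.\<close>

lemma legal_insert_iff:
  assumes "S \<subseteq> {..<i}"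
  shows "legal m (insert i S) \<longleftrightarrow> legal m S \<and> S \<subseteq> {..<bin_start m i}"
proof -
  obtain k where k: "i \<in> bin m k" and uniq: "\<And>k'. i \<in> bin m k' \<Longrightarrow> k' = k"
    using ex1_bin by blast
  have fin: "finite S" using assms finite_subset by blast
  have iS: "i \<notin> S" using assms by auto
  have "card (insert i S \<inter> bin m k') = card (S \<inter> bin m k')" if "k' \<noteq> k" for k'
    using uniq that by (metis Int_insert_left)
  moreover have "card (insert i S \<inter> bin m k) = Suc (card (S \<inter> bin m k))"
    using k fin iS by simp
  ultimately have "legal m (insert i S) \<longleftrightarrow>
      (\<forall>k'. k' \<noteq> k \<longrightarrow> card (S \<inter> bin m k') \<le> 1) \<and> card (S \<inter> bin m k) = 0"
    unfolding legal_def using fin by (metis One_nat_def Suc_le_mono finite_insert le_zero_eq)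
  also have "\<dots> \<longleftrightarrow> legal m S \<and> S \<inter> bin m k = {}"
    unfolding legal_def using fin by (metis card_0_eq finite_Int zero_le)
  also have "S \<inter> bin m k = {} \<longleftrightarrow> S \<subseteq> {..<bin_start m i}"
    using same_bin_iff[OF _ k] assms by (auto simp: subset_iff disjoint_iff not_le)
  finally show ?thesis .
qed

lemma insert_in_legal_sets:
  assumes "S \<in> legal_sets m (bin_start m i)"
  shows "S \<subseteq> {..<i}" "legal m (insert i S)"
proof -
  show "S \<subseteq> {..<i}" using assms bin_start_le[of i] by (auto simp: legal_sets_def)
  then show "legal m (insert i S)"
    using assms legal_insert_iff by (auto simp: legal_sets_def)
qed

text \<open>Split by membership of \<open>i\<close>; removing \<open>i\<close> leaves a legal set
  before its bin. This disjoint recursion drives the closed form, the bijection with numbers and all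
  later counts.\<close>

lemma legal_sets_Suc:
  "legal_sets m (Suc i) = legal_sets m i \<union> insert i ` legal_sets m (bin_start m i)"
proof (intro equalityI subsetI)
  fix S assume S: "S \<in> legal_sets m (Suc i)"
  show "S \<in> legal_sets m i \<union> insert i ` legal_sets m (bin_start m i)"
  proof (cases "i \<in> S")
    case True
    have sub: "S - {i} \<subseteq> {..<i}" using S by (auto simp: legal_sets_def)
    have "legal m (insert i (S - {i}))" using S True by (simp add: legal_sets_def insert_absorb)
    then have "S - {i} \<in> legal_sets m (bin_start m i)"
      using legal_insert_iff[OF sub] by (simp add: legal_sets_def)
    then show ?thesis using True by (metis UnI2 imageI insert_Diff)
  next
    case False
    then show ?thesis using S by (auto simp: legal_sets_def less_Suc_eq)
  qed
next
  fix S assume "S \<in> legal_sets m i \<union> insert i ` legal_sets m (bin_start m i)"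
  then consider "S \<in> legal_sets m i"
    | T where "T \<in> legal_sets m (bin_start m i)" "S = insert i T" by blast
  then show "S \<in> legal_sets m (Suc i)"
  proof cases
    case 1
    then show ?thesis using legal_sets_mono[of i "Suc i" m] by auto
  next
    case 2
    then show ?thesis
      using insert_in_legal_sets[of T i] by (auto simp: legal_sets_def)
  qed
qed

lemma legal_sets_disjoint: "legal_sets m i \<inter> insert i ` legal_sets m j = {}"
  by (auto simp: legal_sets_def)

lemma inj_on_insert_legal_sets: "inj_on (insert i) (legal_sets m (bin_start m i))"
proof (rule inj_onI)
  fix S T assume "S \<in> legal_sets m (bin_start m i)" "T \<in> legal_sets m (bin_start m i)"
    and "insert i S = insert i T"
  moreover from this have "i \<notin> S" "i \<notin> T" using insert_in_legal_sets(1) by blast+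
  ultimately show "S = T" by (metis insert_ident)
qed

section \<open>Closed form of the sequence and uniqueness of decompositions\<close>

lemma gonal_closed_Suc: "gonal_closed m (Suc i) = gonal_closed m i + gonal_closed m (bin_start m i)"
proof (cases i)
  case 0
  then show ?thesis by (simp add: gonal_closed_def bin_start_def)
next
  case (Suc j)
  define q r where "q = j div m" and "r = j mod m"
  have j: "j = m * q + r" and r: "r < m" using m by (auto simp: q_def r_def)
  have st: "gonal_closed m (bin_start m i) = 2 * (m + 1) ^ q"
    using m Suc by (simp add: gonal_closed_def bin_start_def q_def)
  have i: "gonal_closed m i = 2 * (r + 1) * (m + 1) ^ q"
    using Suc by (simp add: gonal_closed_def q_def r_def)
  show ?thesis
  proof (cases "Suc r = m")
    case True
    then have "i = m * Suc q" using j Suc by simp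
    then have "gonal_closed m (Suc i) = 2 * (m + 1) ^ Suc q"
      using m by (simp add: gonal_closed_def algebra_simps del: mult_Suc_right)
    moreover have "gonal_closed m i = 2 * m * (m + 1) ^ q" using i True by simp
    ultimately show ?thesis using st by (simp add: algebra_simps)
  next
    case False
    then have "i = m * q + Suc r" "Suc r < m" using j Suc r by auto
    moreover have "(m * q + p) div m = q" "(m * q + p) mod m = p" if "p < m" for p
      using that by auto
    ultimately have "i div m = q" "i mod m = Suc r" by blast+
    then have "gonal_closed m (Suc i) = 2 * (Suc r + 1) * (m + 1) ^ q"
      by (simp add: gonal_closed_def)
    then show ?thesis using st i by (simp add: algebra_simps)
  qed
qed

text \<open>Induction along \<open>legal_sets_Suc\<close>: sets avoiding the largest index j fill
  [0, a_j), and those containing it fill the adjacent interval obtained by shifting [0, a_s) by a_j,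
  where s starts the bin of j. By \<open>gonal_closed_Suc\<close> the two intervals join
  exactly.\<close>

lemma bij_betw_legal_sets:
  "bij_betw (\<lambda>S. \<Sum>j\<in>S. gonal_closed m j) (legal_sets m i) {0..<gonal_closed m i}"
proof (induction i rule: less_induct)
  case (less i)
  show ?case
  proof (cases i)
    case 0
    then show ?thesis by (auto simp: bij_betw_def gonal_closed_def legal_sets_0)
  next
    case (Suc j)
    let ?f = "\<lambda>S. \<Sum>j\<in>S. gonal_closed m j"
    let ?s = "bin_start m j"
    have "bij_betw ?f (legal_sets m ?s) {0..<gonal_closed m ?s}"
      using less Suc bin_start_le[of j] by simp
    moreover have "bij_betw (\<lambda>z. z + gonal_closed m j) {0..<gonal_closed m ?s}
        {gonal_closed m j..<gonal_closed m i}"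
      using Suc gonal_closed_Suc[of j] by (simp add: bij_betw_def add.commute)
    ultimately have "bij_betw ((\<lambda>z. z + gonal_closed m j) \<circ> ?f) (legal_sets m ?s)
        {gonal_closed m j..<gonal_closed m i}"
      by (rule bij_betw_trans)
    moreover have "((\<lambda>z. z + gonal_closed m j) \<circ> ?f) S = (?f \<circ> insert j) S"
      if "S \<in> legal_sets m ?s" for S
    proof -
      have "j \<notin> S" "finite S" using insert_in_legal_sets(1)[OF that] legal_sets_finite[OF that] by auto
      then show ?thesis by simp
    qed
    ultimately have "bij_betw (?f \<circ> insert j) (legal_sets m ?s)
        {gonal_closed m j..<gonal_closed m i}"
      using bij_betw_cong by blast
    then have "bij_betw ?f (insert j ` legal_sets m ?s) {gonal_closed m j..<gonal_closed m i}"
      using inj_on_insert_legal_sets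
      by (auto simp: bij_betw_def inj_on_def image_comp)
    moreover have "bij_betw ?f (legal_sets m j) {0..<gonal_closed m j}"
      using less Suc by simp
    ultimately have "bij_betw ?f (legal_sets m j \<union> insert j ` legal_sets m ?s)
        ({0..<gonal_closed m j} \<union> {gonal_closed m j..<gonal_closed m i})"
      by (intro bij_betw_combine) auto
    moreover have "{0..<gonal_closed m j} \<union> {gonal_closed m j..<gonal_closed m i} = {0..<gonal_closed m i}"
      using Suc gonal_closed_Suc[of j] by auto
    ultimately show ?thesis using Suc legal_sets_Suc by simp
  qed
qed

text \<open>By induction the greedy sums over sets below \<open>i\<close> use closed-form terms, so
  by the bijection they cover precisely the numbers below \<open>gonal_closed m i\<close>, which is
  then the least one missing.\<close>

lemma gonal_eq_closed: "gonal m i = gonal_closed m i"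
proof (induction i rule: less_induct)
  case (less i)
  have "(\<lambda>S. \<Sum>j\<in>S. gonal m j) ` legal_sets m i = (\<lambda>S. \<Sum>j\<in>S. gonal_closed m j) ` legal_sets m i"
    by (intro image_cong refl sum.cong) (use less in \<open>auto simp: legal_sets_def\<close>)
  also have "\<dots> = {0..<gonal_closed m i}"
    using bij_betw_legal_sets by (simp add: bij_betw_def)
  finally have "gonal m i = (LEAST z. 0 < z \<and> z \<notin> {0..<gonal_closed m i})"
    by (simp add: gonal.simps[of m i] legal_sets_def)
  also have "\<dots> = gonal_closed m i"
    by (rule Least_equality) (auto simp: gonal_closed_def)
  finally show ?case .
qed

lemma card_legal_sets: "card (legal_sets m i) = gonal_closed m i"
  using bij_betw_same_card[OF bij_betw_legal_sets[of i]] by simp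

lemma card_legal_sets_bin: "card (legal_sets m (m * k + 1)) = 2 * (m + 1) ^ k"
  using m by (simp add: card_legal_sets gonal_closed_def)

text \<open>Two legal sets with equal sums are both contained in some \<open>{..<N}\<close>, and
  there the sum map is injective.\<close>

lemma the_decomposition_sum:
  assumes "legal m S"
  shows "the_decomposition m (\<Sum>j\<in>S. gonal m j) = S"
  unfolding the_decomposition_def
proof (rule the_equality)
  show "legal_decomposition m (\<Sum>j\<in>S. gonal m j) S"
    using assms by (simp add: legal_decomposition_def)
next
  fix T assume "legal_decomposition m (\<Sum>j\<in>S. gonal m j) T"
  then have T: "legal m T" and eq: "(\<Sum>j\<in>S. gonal m j) = (\<Sum>j\<in>T. gonal m j)"
    by (auto simp: legal_decomposition_def)
  have "finite (S \<union> T)" using assms T by (simp add: legal_def)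
  then obtain N where "S \<union> T \<subseteq> {..<N}"
    using finite_nat_set_iff_bounded by (metis lessThan_iff subsetI)
  then have "S \<in> legal_sets m N" "T \<in> legal_sets m N"
    using assms T by (auto simp: legal_sets_def)
  then show "T = S"
    using bij_betw_legal_sets[of N] eq by (auto simp: bij_betw_def gonal_eq_closed dest: inj_onD)
qed

end

section \<open>Gaps of a finite set\<close>

definition list_gaps :: "nat list \<Rightarrow> nat multiset" where
  "list_gaps l = mset (map (\<lambda>i. l ! (i + 1) - l ! i) [0..<length l - 1])"

definition set_gaps :: "nat set \<Rightarrow> nat multiset" where
  "set_gaps S = list_gaps (sorted_list_of_set S)"

text \<open>Appending leaves the earlier differences untouched and adds one at the end, unless there
  is no earlier entry to measure from.\<close>

lemma list_gaps_snoc: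
  "list_gaps (l @ [x]) = list_gaps l + (if l = [] then {#} else {#x - last l#})"
proof (cases l rule: rev_cases)
  case Nil
  then show ?thesis by (simp add: list_gaps_def)
next
  case (snoc k y)
  have "map (\<lambda>i. (l @ [x]) ! (i + 1) - (l @ [x]) ! i) [0..<length k]
      = map (\<lambda>i. l ! (i + 1) - l ! i) [0..<length k]"
    using snoc by (intro map_cong refl) (auto simp: nth_append less_Suc_eq)
  moreover have "[0..<length (l @ [x]) - 1] = [0..<length k] @ [length k]"
    "[0..<length l - 1] = [0..<length k]"
    using snoc by auto
  moreover have "(l @ [x]) ! (length k + 1) - (l @ [x]) ! length k = x - last l" "l \<noteq> []"
    using snoc by (auto simp: nth_append)
  ultimately show ?thesis
    unfolding list_gaps_def by (simp only: map_append mset_append list.map mset.simps if_False)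
qed

lemma sorted_list_of_set_insert_greater:
  assumes "finite S" "S \<subseteq> {..<i}"
  shows "sorted_list_of_set (insert i S) = sorted_list_of_set S @ [i]"
proof -
  have "sorted_list_of_set (insert i S) = insort i (sorted_list_of_set S)"
    using assms by (intro sorted_list_of_set_insert) auto
  also have "\<dots> = sorted_list_of_set S @ [i]"
    using assms by (intro sorted_insort_is_snoc) (auto intro: less_imp_le)
  finally show ?thesis .
qed

lemma last_sorted_list_of_set:
  assumes "finite (S :: nat set)" "S \<noteq> {}"
  shows "last (sorted_list_of_set S) = Max S"
proof -
  have "S - {Max S} \<subseteq> {..<Max S}"
    using assms by (auto simp: order_less_le)
  then have "sorted_list_of_set (insert (Max S) (S - {Max S})) = sorted_list_of_set (S - {Max S}) @ [Max S]"
    using assms by (intro sorted_list_of_set_insert_greater) auto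
  then show ?thesis using assms by (simp add: insert_absorb)
qed

lemma set_gaps_insert:
  assumes "finite S" "S \<subseteq> {..<i}"
  shows "set_gaps (insert i S) = set_gaps S + (if S = {} then {#} else {#i - Max S#})"
  unfolding set_gaps_def sorted_list_of_set_insert_greater[OF assms] list_gaps_snoc
  using assms by (simp add: last_sorted_list_of_set)

section \<open>Recurrences for the gap counts\<close>

context
  fixes m :: nat
  assumes m: "m \<ge> 1"
begin

text \<open>Reindexing by the bijection replaces numbers by their index sets, so that gaps can be
  counted without reference to values of the sequence.\<close>

lemma all_gaps_eq: "all_gaps m n = (\<Sum>S\<in>legal_sets m (m * n + 1). set_gaps S)"
proof -
  let ?f = "\<lambda>S. \<Sum>j\<in>S. gonal m j"
  have "bij_betw ?f (legal_sets m (m * n + 1)) {0..<gonal m (m * n + 1)}"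
    using bij_betw_legal_sets[OF m] by (simp add: gonal_eq_closed[OF m])
  then have "all_gaps m n = (\<Sum>S\<in>legal_sets m (m * n + 1). gaps m (?f S))"
    unfolding all_gaps_def by (rule sum.reindex_bij_betw[symmetric])
  also have "\<dots> = (\<Sum>S\<in>legal_sets m (m * n + 1). set_gaps S)"
    by (intro sum.cong refl)
       (simp add: gaps_def set_gaps_def list_gaps_def Let_def legal_sets_def the_decomposition_sum[OF m])
  finally show ?thesis .
qed

lemma sum_legal_sets_Suc:
  fixes f :: "nat set \<Rightarrow> 'a :: comm_monoid_add"
  shows "(\<Sum>S\<in>legal_sets m (Suc i). f S)
    = (\<Sum>S\<in>legal_sets m i. f S) + (\<Sum>S\<in>legal_sets m (bin_start m i). f (insert i S))"
  unfolding legal_sets_Suc[OF m]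
  by (subst sum.union_disjoint)
     (auto simp: finite_legal_sets legal_sets_disjoint[OF m] sum.reindex[OF inj_on_insert_legal_sets[OF m]])

text \<open>All indices \<open>m * n + 1 + q\<close> with q < m share the bin start
  \<open>m * n + 1\<close>, so each of them extends the same family of sets.\<close>

lemma sum_legal_sets_bin:
  fixes f :: "nat set \<Rightarrow> 'a :: comm_monoid_add"
  assumes "r \<le> m"
  shows "(\<Sum>S\<in>legal_sets m (m * n + 1 + r). f S)
    = (\<Sum>S\<in>legal_sets m (m * n + 1). f S)
      + (\<Sum>q<r. \<Sum>S\<in>legal_sets m (m * n + 1). f (insert (m * n + 1 + q) S))"
  using assms
proof (induction r)
  case (Suc r)
  have "bin_start m (m * n + 1 + r) = m * n + 1"
    using Suc.prems by (simp add: bin_start_def)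
  then show ?case using Suc sum_legal_sets_Suc[of f "m * n + 1 + r"] by (simp add: add.assoc)
qed simp

lemma all_gaps_Suc:
  "all_gaps m (Suc n) = all_gaps m n + (\<Sum>q<m. all_gaps m n
      + (\<Sum>S\<in>legal_sets m (m * n + 1) - {{}}. {#m * n + 1 + q - Max S#}))"
proof -
  let ?L = "legal_sets m (m * n + 1)"
  have "set_gaps (insert (m * n + 1 + q) S)
      = set_gaps S + (if S = {} then {#} else {#m * n + 1 + q - Max S#})" if "S \<in> ?L" for q S
    by (rule set_gaps_insert) (use that legal_sets_finite[OF that] in \<open>auto simp: legal_sets_def\<close>)
  then have "(\<Sum>S\<in>?L. set_gaps (insert (m * n + 1 + q) S))
      = (\<Sum>S\<in>?L. set_gaps S) + (\<Sum>S\<in>?L. if S = {} then {#} else {#m * n + 1 + q - Max S#})" for q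
    by (simp add: sum.distrib)
  also have "(\<Sum>S\<in>?L. if S = {} then {#} else {#m * n + 1 + q - Max S#})
      = (\<Sum>S\<in>?L - {{}}. {#m * n + 1 + q - Max S#})" for q
    by (rule sum.mono_neutral_cong_right) (auto simp: finite_legal_sets)
  finally have step: "(\<Sum>S\<in>?L. set_gaps (insert (m * n + 1 + q) S))
      = all_gaps m n + (\<Sum>S\<in>?L - {{}}. {#m * n + 1 + q - Max S#})" for q
    unfolding all_gaps_eq .
  have "m * Suc n + 1 = m * n + 1 + m" by simp
  then have "all_gaps m (Suc n) = (\<Sum>S\<in>legal_sets m (m * n + 1 + m). set_gaps S)"
    by (simp only: all_gaps_eq)
  also have "\<dots> = all_gaps m n + (\<Sum>q<m. \<Sum>S\<in>?L. set_gaps (insert (m * n + 1 + q) S))"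
    unfolding all_gaps_eq by (rule sum_legal_sets_bin) simp
  finally show ?thesis unfolding step .
qed

section \<open>Total number of gaps\<close>

lemma size_all_gaps_Suc:
  "size (all_gaps m (Suc n)) = (m + 1) * size (all_gaps m n) + m * (2 * (m + 1) ^ n - 1)"
proof -
  \<comment> \<open>The empty set is left out because extending it creates no gap.\<close>
  have "card (legal_sets m (m * n + 1) - {{}}) = 2 * (m + 1) ^ n - 1"
    using card_legal_sets_bin[OF m, of n] empty_in_legal_sets by (simp add: finite_legal_sets)
  then show ?thesis
    by (simp add: all_gaps_Suc size_multiset_sum algebra_simps)
qed

text \<open>Solves the recurrence: the constant 1 is the fixed point of x = (m + 1) x - m, the first
  term absorbs the resonant forcing 2m(m+1)^n, and the coefficient -1 of (m+1)^n is forced by the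
  value 0 at n = 0. Dividing by m + 1 avoids the exponent n - 1.\<close>

lemma size_all_gaps:
  "real (size (all_gaps m n)) = 2 * real m * real n * (real m + 1) ^ n / (real m + 1) - (real m + 1) ^ n + 1"
proof (induction n)
  case 0
  have "legal_sets m (Suc 0) = {{}, {0}}"
    by (simp add: legal_sets_Suc[OF m] bin_start_def legal_sets_0 insert_commute)
  then show ?case by (simp add: all_gaps_eq set_gaps_def list_gaps_def)
next
  case (Suc n)
  have "real (2 * (m + 1) ^ n - 1) = 2 * (real m + 1) ^ n - 1"
    by (subst of_nat_diff) (auto simp: Suc_le_eq add.commute)
  then have "real (size (all_gaps m (Suc n)))
      = (real m + 1) * real (size (all_gaps m n)) + real m * (2 * (real m + 1) ^ n - 1)"
    by (simp only: size_all_gaps_Suc of_nat_add of_nat_mult of_nat_1)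
  also have "\<dots> = 2 * real m * real (Suc n) * (real m + 1) ^ Suc n / (real m + 1) - (real m + 1) ^ Suc n + 1"
    unfolding Suc.IH by (simp add: field_simps)
  finally show ?case .
qed

section \<open>Number of gaps of a given length\<close>

lemma legal_sets_Max:
  assumes "x < i"
  shows "{S \<in> legal_sets m i. S \<noteq> {} \<and> Max S = x} = insert x ` legal_sets m (bin_start m x)"
proof (intro equalityI subsetI)
  fix S assume "S \<in> {S \<in> legal_sets m i. S \<noteq> {} \<and> Max S = x}"
  then have S: "S \<in> legal_sets m i" "S \<noteq> {}" "Max S = x" by auto
  have fin: "finite S" using S(1) by (rule legal_sets_finite)
  have "x \<in> S" using Max_in[OF fin S(2)] S(3) by simp
  moreover have "y < Suc x" if "y \<in> S" for y using Max_ge[OF fin that] S(3) by simp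
  \<comment> \<open>Membership at \<open>Suc x\<close> but not at \<open>x\<close> leaves only the
    second part of the union in \<open>legal_sets_Suc\<close>.\<close>
  ultimately have "S \<in> legal_sets m (Suc x)" "S \<notin> legal_sets m x" using S by (auto simp: legal_sets_def)
  then show "S \<in> insert x ` legal_sets m (bin_start m x)"
    using legal_sets_Suc[OF m] by blast
next
  fix S assume "S \<in> insert x ` legal_sets m (bin_start m x)"
  then obtain T where T: "T \<in> legal_sets m (bin_start m x)" "S = insert x T" by auto
  then have sub: "T \<subseteq> {..<x}" using insert_in_legal_sets(1)[OF m] by blast
  have "S \<in> legal_sets m (Suc x)" using T legal_sets_Suc[OF m] by blast
  then have "S \<in> legal_sets m i" using assms legal_sets_mono[of "Suc x" i m] by auto
  moreover have "Max S = x"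
    using T sub by (intro Max_eqI) (auto simp: legal_sets_finite less_imp_le)
  ultimately show "S \<in> {S \<in> legal_sets m i. S \<noteq> {} \<and> Max S = x}" using T by auto
qed

text \<open>The maximum lies in bin k + 1 and the rest is an arbitrary legal set in bins 0 to k, so
  the count does not depend on the offset \<open>r\<close>.\<close>

lemma card_legal_sets_Max:
  assumes "m * k + r + 1 < i" "r < m"
  shows "card {S \<in> legal_sets m i. S \<noteq> {} \<and> Max S = m * k + r + 1} = 2 * (m + 1) ^ k"
proof -
  have "bin_start m (m * k + r + 1) = m * k + 1"
    using assms(2) by (simp add: bin_start_def)
  then show ?thesis
    unfolding legal_sets_Max[OF assms(1)]
    using card_image[OF inj_on_insert_legal_sets[OF m, of "m * k + r + 1"]] card_legal_sets_bin[OF m, of k]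
    by simp
qed

lemma count_all_gaps_Suc:
  "count (all_gaps m (Suc n)) g = (m + 1) * count (all_gaps m n) g
     + (\<Sum>q<m. card {S \<in> legal_sets m (m * n + 1). S \<noteq> {} \<and> m * n + 1 + q - Max S = g})"
proof -
  let ?L = "legal_sets m (m * n + 1)"
  have "(\<Sum>S\<in>?L - {{}}. count {#m * n + 1 + q - Max S#} g)
      = card {S \<in> ?L. S \<noteq> {} \<and> m * n + 1 + q - Max S = g}" for q
  proof -
    have "(\<Sum>S\<in>?L - {{}}. count {#m * n + 1 + q - Max S#} g)
        = (\<Sum>S\<in>?L - {{}}. if m * n + 1 + q - Max S = g then 1 else 0)"
      by (intro sum.cong) auto
    also have "\<dots> = card {S \<in> ?L - {{}}. m * n + 1 + q - Max S = g}"
      by (simp add: finite_legal_sets flip: sum.inter_filter)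
    also have "{S \<in> ?L - {{}}. m * n + 1 + q - Max S = g}
        = {S \<in> ?L. S \<noteq> {} \<and> m * n + 1 + q - Max S = g}" by auto
    finally show ?thesis .
  qed
  then show ?thesis
    by (simp add: all_gaps_Suc count_sum sum.distrib)
qed

text \<open>The new gap is \<open>g\<close> exactly when the old maximum is mn + 1 + q - g.
  Subtracting \<beta> from the offset q borrows from the quotient iff q < \<beta>, which puts the
  maximum in bin n - \<alpha>; otherwise it falls in bin n - \<alpha> + 1. For \<alpha> = 0 the
  latter is the new bin itself, which contains no old maximum. The bound on \<open>n\<close> keeps
  the required maximum positive.\<close>

lemma card_new_gaps:
  assumes g: "g = m * \<alpha> + \<beta>" "\<beta> < m" "g \<ge> 1" and n: "n \<ge> Suc \<alpha>" and q: "q < m"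
  shows "card {S \<in> legal_sets m (m * n + 1). S \<noteq> {} \<and> m * n + 1 + q - Max S = g}
    = (if q < \<beta> then 2 * (m + 1) ^ (n - Suc \<alpha>) else if \<alpha> = 0 then 0 else 2 * (m + 1) ^ (n - \<alpha>))"
proof -
  let ?L = "legal_sets m (m * n + 1)"
  obtain d where d: "n = Suc \<alpha> + d" using n le_Suc_ex by blast
  have Max_le: "Max S \<le> m * n" if "S \<in> ?L" "S \<noteq> {}" for S
    using that legal_sets_finite[OF that(1)] Max_in[of S] by (auto simp: legal_sets_def)
  have expand: "m * n = m * \<alpha> + m * d + m" by (simp add: d algebra_simps)
  consider "q < \<beta>" | "\<beta> \<le> q" "\<alpha> = 0" | "\<beta> \<le> q" "\<alpha> \<noteq> 0" by linarith
  then show ?thesis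
  proof cases
    case 1
    let ?x = "m * d + (m + q - \<beta>) + 1"
    have "m * n + 1 + q - Max S = g \<longleftrightarrow> Max S = ?x" if "S \<in> ?L" "S \<noteq> {}" for S
      using Max_le[OF that] expand g 1 by linarith
    then have "{S \<in> ?L. S \<noteq> {} \<and> m * n + 1 + q - Max S = g} = {S \<in> ?L. S \<noteq> {} \<and> Max S = ?x}"
      by blast
    moreover have "card {S \<in> ?L. S \<noteq> {} \<and> Max S = ?x} = 2 * (m + 1) ^ d"
      by (rule card_legal_sets_Max) (use 1 g expand in linarith)+
    ultimately show ?thesis using 1 d by simp
  next
    case 2
    \<comment> \<open>Here every new gap is at least q + 1, whereas g = \<beta> \<le> q.\<close>
    have "m * n + 1 + q - Max S \<noteq> g" if "S \<in> ?L" "S \<noteq> {}" for S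
      using Max_le[OF that] 2 g by simp
    then have "{S \<in> ?L. S \<noteq> {} \<and> m * n + 1 + q - Max S = g} = {}" by blast
    then have "card {S \<in> ?L. S \<noteq> {} \<and> m * n + 1 + q - Max S = g} = 0" by (simp only: card.empty)
    then show ?thesis using 2 by (simp only: if_True if_False not_less[symmetric]) simp
  next
    case 3
    let ?x = "m * Suc d + (q - \<beta>) + 1"
    have "m * n + 1 + q - Max S = g \<longleftrightarrow> Max S = ?x" if "S \<in> ?L" "S \<noteq> {}" for S
      using Max_le[OF that] expand g 3 mult_Suc_right[of m d] by linarith
    then have "{S \<in> ?L. S \<noteq> {} \<and> m * n + 1 + q - Max S = g} = {S \<in> ?L. S \<noteq> {} \<and> Max S = ?x}"
      by blast
    moreover have "?x < m * n + 1"
    proof -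
      \<comment> \<open>\<alpha> \<ge> 1 moves the required maximum at least one full bin below the
        new one.\<close>
      have "m \<le> m * \<alpha>" using 3 by simp
      then show ?thesis using expand 3(1) q mult_Suc_right[of m d] by linarith
    qed
    then have "card {S \<in> ?L. S \<noteq> {} \<and> Max S = ?x} = 2 * (m + 1) ^ Suc d"
      by (rule card_legal_sets_Max) (use q in linarith)
    ultimately have "card {S \<in> ?L. S \<noteq> {} \<and> m * n + 1 + q - Max S = g} = 2 * (m + 1) ^ Suc d"
      by (simp only:)
    moreover have "n - \<alpha> = Suc d" using d by simp
    ultimately show ?thesis using 3 by (simp only: not_less[symmetric] if_False)
  qed
qed

text \<open>Of the m offsets q, \<beta> borrow and m - \<beta> do not; summing
  \<open>card_new_gaps\<close> over both groups gives the two forcing terms.\<close>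

lemma count_all_gaps_Suc_eventually:
  assumes g: "g = m * \<alpha> + \<beta>" "\<beta> < m" "g \<ge> 1" and n: "n \<ge> Suc \<alpha>"
  shows "count (all_gaps m (Suc n)) g = (m + 1) * count (all_gaps m n) g
     + \<beta> * (2 * (m + 1) ^ (n - Suc \<alpha>))
     + (if \<alpha> = 0 then 0 else (m - \<beta>) * (2 * (m + 1) ^ (n - \<alpha>)))"
proof -
  define A where "A = 2 * (m + 1) ^ (n - Suc \<alpha>)"
  define B where "B = (if \<alpha> = 0 then 0 else 2 * (m + 1) ^ (n - \<alpha>))"
  have "(\<Sum>q<m. card {S \<in> legal_sets m (m * n + 1). S \<noteq> {} \<and> m * n + 1 + q - Max S = g})
      = (\<Sum>q<m. if q < \<beta> then A else B)"
    using card_new_gaps[OF assms] by (intro sum.cong) (auto simp: A_def B_def)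
  also have "\<dots> = (\<Sum>q\<in>{..<m} \<inter> {q. q < \<beta>}. A) + (\<Sum>q\<in>{..<m} \<inter> - {q. q < \<beta>}. B)"
    by (rule sum.If_cases) simp
  also have "{..<m} \<inter> {q. q < \<beta>} = {..<\<beta>}" using g by auto
  also have "{..<m} \<inter> - {q. q < \<beta>} = {\<beta>..<m}" by auto
  finally show ?thesis
    unfolding count_all_gaps_Suc by (simp add: A_def B_def)
qed

end

section \<open>The limit\<close>

text \<open>From N on, u is an arithmetic progression with difference K. It is meant for gap counts
  divided by (m+1)^n, whose recurrence then has constant increments.\<close>

lemma tendsto_div_n_of_const_diff:
  fixes u :: "nat \<Rightarrow> real"
  assumes "\<And>n. n \<ge> N \<Longrightarrow> u (Suc n) = u n + K"
  shows "(\<lambda>n. u n / real n) \<longlonglongrightarrow> K"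
proof -
  have u: "u n = u N + K * (real n - real N)" if "n \<ge> N" for n
    using that by (induction n rule: dec_induct) (auto simp: assms algebra_simps)
  have "(\<lambda>n. (u N - K * real N) * (1 / real n) + K) \<longlonglongrightarrow> (u N - K * real N) * 0 + K"
    by (intro tendsto_intros lim_1_over_n)
  moreover have "eventually (\<lambda>n. (u N - K * real N) * (1 / real n) + K = u n / real n) sequentially"
    using eventually_ge_at_top[of "Suc N"]
    by eventually_elim (subst u, auto simp: field_simps)
  ultimately show ?thesis using Lim_transform_eventually by fastforce
qed

lemma size_all_gaps_asymp:
  assumes "m \<ge> 1"
  shows "(\<lambda>n. real (size (all_gaps m n)) / (real m + 1) ^ n / real n)
    \<longlonglongrightarrow> 2 * real m / (real m + 1)"
proof -
  let ?M = "real m + 1"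
  have "(\<lambda>n. 2 * real m / ?M - 1 / real n + (1 / ?M) ^ n * (1 / real n))
      \<longlonglongrightarrow> 2 * real m / ?M - 0 + 0 * 0"
    by (intro tendsto_intros lim_1_over_n LIMSEQ_realpow_zero) (use assms in auto)
  moreover have "eventually (\<lambda>n. 2 * real m / ?M - 1 / real n + (1 / ?M) ^ n * (1 / real n)
      = real (size (all_gaps m n)) / ?M ^ n / real n) sequentially"
    using eventually_gt_at_top[of 0]
  proof eventually_elim
    case (elim n)
    \<comment> \<open>Stated for arbitrary nonzero reals, so that the powers act as opaque
      atoms.\<close>
    have "2 * a / M - 1 / x + 1 / A * (1 / x) = (2 * a * x * A / M - A + 1) / A / x"
      if "M \<noteq> 0" "A \<noteq> 0" "x \<noteq> 0" for a M A x :: real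
      using that by (simp add: divide_simps) (simp add: algebra_simps)
    from this[of ?M "?M ^ n" "real n" "real m"] show ?case
      using elim by (simp add: size_all_gaps[OF assms] power_one_over)
  qed
  ultimately show ?thesis using Lim_transform_eventually by fastforce
qed

text \<open>Dividing the recurrence by (m+1)^(n+1) turns the forcing terms with powers n - \<alpha>
  - 1 and n - \<alpha> into constants with denominators (m+1)^(\<alpha>+2) and (m+1)^(\<alpha>+1);
  their sum is the increment, hence the limit.\<close>

lemma count_all_gaps_asymp:
  fixes m g \<alpha> \<beta> :: nat
  assumes "m \<ge> 1" "g = m * \<alpha> + \<beta>" "\<beta> < m" "g \<ge> 1"
  shows "(\<lambda>n. real (count (all_gaps m n) g) / (real m + 1) ^ n / real n)
    \<longlonglongrightarrow> 2 * real \<beta> / (real m + 1) ^ (\<alpha> + 2)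
      + (if \<alpha> = 0 then 0 else 2 * (real m - real \<beta>) / (real m + 1) ^ (\<alpha> + 1))"
proof (rule tendsto_div_n_of_const_diff[where N = "Suc \<alpha>"])
  fix n assume n: "n \<ge> Suc \<alpha>"
  let ?M = "real m + 1"
  obtain d where d: "n = Suc \<alpha> + d" using n le_Suc_ex by blast
  have rec: "real (count (all_gaps m (Suc n)) g) = ?M * real (count (all_gaps m n) g)
     + 2 * real \<beta> * ?M ^ d + (if \<alpha> = 0 then 0 else 2 * (real m - real \<beta>) * ?M ^ Suc d)"
  proof -
    have "real (m - \<beta>) = real m - real \<beta>" "n - Suc \<alpha> = d" "n - \<alpha> = Suc d"
      using assms(3) d by auto
    then show ?thesis
      unfolding count_all_gaps_Suc_eventually[OF assms n]
      by (cases "\<alpha> = 0")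
         (simp_all only: of_nat_add of_nat_mult of_nat_power of_nat_1 of_nat_0 of_nat_numeral if_True if_False simp_thms mult_ac)
  qed
  \<comment> \<open>\<open>e\<close> hides the case distinction on \<alpha>, so that one algebraic
    identity serves both cases.\<close>
  define e where "e = (if \<alpha> = 0 then 0 else 2 * (real m - real \<beta>))"
  have e: "(if \<alpha> = 0 then 0 else 2 * (real m - real \<beta>) * ?M ^ Suc d) = e * (?M * ?M ^ d)"
    "(if \<alpha> = 0 then 0 else 2 * (real m - real \<beta>) / ?M ^ (\<alpha> + 1)) = e / (?M ^ \<alpha> * ?M)"
    by (simp_all add: e_def)
  have pow: "?M ^ Suc n = ?M * (?M * ?M ^ \<alpha> * ?M ^ d)" "?M ^ n = ?M * ?M ^ \<alpha> * ?M ^ d"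
    "?M ^ (\<alpha> + 2) = ?M ^ \<alpha> * (?M * ?M)"
    by (simp_all add: d power_add power2_eq_square)
  have "(M * c + b * D + t * (M * D)) / (M * (M * A * D)) = c / (M * A * D) + (b / (A * (M * M)) + t / (A * M))"
    if "M \<noteq> 0" "A \<noteq> 0" "D \<noteq> 0" for M A D c b t :: real
    using that by (simp add: divide_simps) (simp add: algebra_simps)
  from this[of ?M "?M ^ \<alpha>" "?M ^ d"]
  show "real (count (all_gaps m (Suc n)) g) / ?M ^ Suc n = real (count (all_gaps m n) g) / ?M ^ n
     + (2 * real \<beta> / ?M ^ (\<alpha> + 2) + (if \<alpha> = 0 then 0 else 2 * (real m - real \<beta>) / ?M ^ (\<alpha> + 1)))"
    unfolding rec e pow by simp
qed

theorem theorem1p4: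
  fixes m g \<alpha> \<beta> :: nat
  assumes "m \<ge> 1" and "g = m * \<alpha> + \<beta>" and "\<beta> < m" and "g \<ge> 1"
  shows "(\<lambda>n. gap_fraction m n g) \<longlonglongrightarrow>
           (if \<alpha> = 0 then real \<beta> / (real m * (real m + 1))
            else (real m + 1 - real \<beta>) / (real m + 1) ^ (\<alpha> + 1))"
proof -
  let ?M = "real m + 1"
  let ?K = "2 * real \<beta> / ?M ^ (\<alpha> + 2) + (if \<alpha> = 0 then 0 else 2 * (real m - real \<beta>) / ?M ^ (\<alpha> + 1))"
  \<comment> \<open>Both counts are normalised by n(m+1)^n; the factor cancels for n > 0, and the
    limit of the denominator is nonzero.\<close>
  have "(\<lambda>n. (real (count (all_gaps m n) g) / ?M ^ n / real n)
        / (real (size (all_gaps m n)) / ?M ^ n / real n)) \<longlonglongrightarrow> ?K / (2 * real m / ?M)"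
    by (intro tendsto_divide count_all_gaps_asymp size_all_gaps_asymp assms) (use assms in auto)
  moreover have "eventually (\<lambda>n. (real (count (all_gaps m n) g) / ?M ^ n / real n)
        / (real (size (all_gaps m n)) / ?M ^ n / real n) = gap_fraction m n g) sequentially"
    using eventually_gt_at_top[of 0]
    by eventually_elim (simp add: gap_fraction_def)
  ultimately have "(\<lambda>n. gap_fraction m n g) \<longlonglongrightarrow> ?K / (2 * real m / ?M)"
    using Lim_transform_eventually by fastforce
  also have "?K / (2 * real m / ?M) = (if \<alpha> = 0 then real \<beta> / (real m * ?M)
      else (?M - real \<beta>) / ?M ^ (\<alpha> + 1))"
  proof -
    have nz: "?M \<noteq> 0" "real m \<noteq> 0" using assms(1) by auto
    have zero: "(2 * b / M\<^sup>2 + 0) / (2 * x / M) = b / (x * M)"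
      if "M \<noteq> 0" "x \<noteq> 0" for M x b :: real
      using that by (simp add: divide_simps power2_eq_square)
    \<comment> \<open>With M = x + 1 the numerator b + M(x - b) equals x(M - b), so the factor x
      cancels.\<close>
    have pos: "(2 * b / (M * A) + 2 * (x - b) / A) / (2 * x / M) = (M - b) / A"
      if "M = x + 1" "M \<noteq> 0" "x \<noteq> 0" "A \<noteq> 0" for M A x b :: real
      using that(2-) by (simp add: divide_simps) (simp add: that(1) algebra_simps)
    show ?thesis
    proof (cases "\<alpha> = 0")
      case True
      then show ?thesis using zero[OF nz, of "real \<beta>"] by (simp add: power2_eq_square)
    next
      case False
      have "?M ^ (\<alpha> + 2) = ?M * ?M ^ (\<alpha> + 1)" by simp
      then show ?thesis
        using False pos[OF refl nz, of "?M ^ (\<alpha> + 1)" "real \<beta>"] nz by (simp only:) simp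
    qed
  qed
  finally show ?thesis .
qed

end
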